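(* Let $l,k,m$ be positive integers. Then a positive real number $\alpha$ satisfies $$\alpha^{l+k}-m\alpha^l\in \mathbb{Z}\cap [1,(m+1)^{l/k})$$ if and only if the identity $$[[n\alpha^l]\alpha^k]+[nm\alpha^l]+1-m[n\alpha^l]=[n\alpha^{l+k}]$$ holds for all $n\in\mathbb{Z}\setminus\{0\}$.
   Context: For a real number $x$, $[x]$ denotes its integer part (the largest integer not exceeding $x$). *)

theory Defs
  imports Complex_Main
begin

end

theory Submission
  imports Defs "HOL-Analysis.Kronecker_Approximation_Theorem"
begin

text \<open>
  Put \<open>a = \<alpha>\<^sup>l\<close>, \<open>d = \<alpha>\<^sup>k - m\<close>, \<open>c = a d\<close> and let \<open>\<theta>\<close> be the fractional part of \<open>n a\<close>. The identity at \<open>n\<close> says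
  \<open>\<lfloor>n c - \<theta> d\<rfloor> + \<lfloor>m \<theta>\<rfloor> + 1 = \<lfloor>m \<theta> + n c\<rfloor>\<close>.
  If \<open>c\<close> is an integer in the given range, then \<open>0 < d < 1\<close>, and \<open>a\<close> is irrational by the rational
  root theorem, so \<open>0 < \<theta> d < 1\<close> and the identity holds.
  Conversely, the identity makes \<open>a\<close> irrational and keeps \<open>n c\<close> within \<open>O(\<theta>)\<close> of an integer whenever
  \<open>\<theta> < 1/m\<close>. Thus \<open>n a \<mapsto> n c\<close> is a Lipschitz homomorphism modulo 1, which forces \<open>c = s a + t\<close> with
  integers \<open>s\<close>, \<open>t\<close>. The identity becomes
  \<open>\<lfloor>(s - d) \<theta>\<rfloor> + \<lfloor>m \<theta>\<rfloor> + 1 = \<lfloor>(m + s) \<theta>\<rfloor>\<close> on a dense set of \<open>\<theta>\<close>, and letting \<open>\<theta>\<close> tend to \<open>0\<close>, \<open>1\<close>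
  and \<open>1/m\<close> leaves only \<open>s = 0\<close> and \<open>0 < d < 1\<close>.
\<close>

section \<open>Reduction of the identity to fractional parts\<close>

text \<open>Replacing \<open>n a\<close> by its fractional part shifts each of the three large
  floors by the same integer \<open>m * A\<close>, where \<open>A\<close> is the integer part of
  \<open>n a\<close>; together with the subtracted \<open>m * A\<close> the shifts cancel.\<close>

lemma floor_identity_iff:
  fixes a b :: real and m :: nat and n :: int
  defines "\<theta> \<equiv> frac (of_int n * a)" and "d \<equiv> b - real m"
  shows "\<lfloor>of_int \<lfloor>of_int n * a\<rfloor> * b\<rfloor> + \<lfloor>of_int n * real m * a\<rfloor> + 1 - int m * \<lfloor>of_int n * a\<rfloor>
      = \<lfloor>of_int n * (a * b)\<rfloor>
    \<longleftrightarrow> \<lfloor>of_int n * (a * d) - \<theta> * d\<rfloor> + \<lfloor>real m * \<theta>\<rfloor> + 1 = \<lfloor>real m * \<theta> + of_int n * (a * d)\<rfloor>"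
proof -
  define A where "A = \<lfloor>of_int n * a\<rfloor>"
  have na: "of_int n * a = of_int A + \<theta>"
    by (simp add: A_def \<theta>_def frac_def)
  have "of_int A * b = (of_int n * a - \<theta>) * b"
    by (simp add: na)
  also have "\<dots> = (of_int n * (a * d) - \<theta> * d) + real m * (of_int n * a - \<theta>)"
    by (simp add: d_def algebra_simps)
  also have "\<dots> = (of_int n * (a * d) - \<theta> * d) + of_int (int m * A)"
    by (simp add: na)
  finally have 1: "\<lfloor>of_int A * b\<rfloor> = \<lfloor>of_int n * (a * d) - \<theta> * d\<rfloor> + int m * A"
    by (metis floor_add_int)
  have "of_int n * real m * a = real m * (of_int n * a)" by simp
  also have "\<dots> = real m * \<theta> + of_int (int m * A)"
    unfolding na by (simp add: algebra_simps)
  finally have nma: "of_int n * real m * a = real m * \<theta> + of_int (int m * A)" .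
  then have 2: "\<lfloor>of_int n * real m * a\<rfloor> = \<lfloor>real m * \<theta>\<rfloor> + int m * A"
    by (metis floor_add_int)
  have "of_int n * (a * b) = of_int n * (a * d) + of_int n * real m * a"
    by (simp add: d_def algebra_simps)
  also have "\<dots> = (real m * \<theta> + of_int n * (a * d)) + of_int (int m * A)"
    using nma by simp
  finally have 3: "\<lfloor>of_int n * (a * b)\<rfloor> = \<lfloor>real m * \<theta> + of_int n * (a * d)\<rfloor> + int m * A"
    by (metis floor_add_int)
  show ?thesis
    unfolding 2 3 using 1 by (simp add: A_def) linarith
qed

section \<open>Irrationality of \<open>\<alpha> ^ l\<close>\<close>

lemma rational_root_trinomial_int:
  fixes x c :: real and m :: nat
  assumes "x \<in> \<rat>" "t > 0" "c \<in> \<int>" "x ^ (s + t) - real m * x ^ s = c"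
  shows "x \<in> \<int>"
proof -
  obtain p q where pq: "q > 0" "coprime p q" "x = of_int p / of_int q"
    using assms(1) by (meson Rats_cases')
  obtain z where z: "c = of_int z" using assms(3) Ints_cases by blast
  have "real_of_int (p ^ (s + t)) = x ^ (s + t) * of_int q ^ (s + t)"
    using pq by (simp add: power_divide)
  also have "\<dots> = real m * (x ^ s * of_int q ^ s) * of_int q ^ t + of_int z * of_int q ^ (s + t)"
    using assms(4) unfolding z by (simp add: power_add algebra_simps)
  also have "x ^ s * of_int q ^ s = of_int (p ^ s)"
    using pq by (simp add: power_divide)
  also have "real m * of_int (p ^ s) * of_int q ^ t + of_int z * of_int q ^ (s + t)
      = of_int (int m * p ^ s * q ^ t + z * q ^ (s + t))"
    by simp
  finally have "p ^ (s + t) = q ^ t * (int m * p ^ s + z * q ^ s)"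
    by (subst (asm) of_int_eq_iff) (simp add: algebra_simps power_add)
  moreover have "q dvd q ^ t" using \<open>t > 0\<close> by simp
  ultimately have "q dvd p ^ (s + t)" by simp
  moreover have "coprime (p ^ (s + t)) q" using pq(2) by simp
  ultimately have "is_unit q" by (metis coprime_common_divisor dvd_refl)
  then have "q = 1" using pq(1) by simp
  then show ?thesis using pq(3) by simp
qed

text \<open>By Bezout, the power is a quotient of powers of \<open>x ^ l\<close> and
  \<open>x ^ k\<close>.\<close>

lemma Rats_power_gcd:
  fixes x :: real
  assumes "x > 0" "l > 0" "x ^ l \<in> \<rat>" "x ^ k \<in> \<rat>"
  shows "x ^ gcd l k \<in> \<rat>"
proof -
  obtain u v where uv: "l * u = k * v + gcd l k"
    using bezout_nat[of l k] assms(2) by auto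
  have "(x ^ l) ^ u = (x ^ k) ^ v * x ^ gcd l k"
    by (metis uv power_add power_mult)
  then have "x ^ gcd l k = (x ^ l) ^ u / (x ^ k) ^ v"
    using assms(1) by (simp add: field_simps)
  then show ?thesis using assms by (metis Rats_divide Rats_power)
qed

text \<open>If \<open>x ^ l\<close> were rational, so would be \<open>x ^ k\<close>, hence
  \<open>x ^ gcd l k\<close>. The latter is a root of a monic integer trinomial, so it is an
  integer, and \<open>x ^ k\<close> would be an integer strictly between \<open>m\<close> and
  \<open>m + 1\<close>.\<close>

lemma trinomial_power_irrational:
  fixes x :: real and m :: nat
  assumes "x > 0" "l > 0" "k > 0" "x ^ (l + k) - real m * x ^ l \<in> \<int>"
    and "real m < x ^ k" "x ^ k < real m + 1"
  shows "x ^ l \<notin> \<rat>"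
proof
  assume rat: "x ^ l \<in> \<rat>"
  define c where "c = x ^ (l + k) - real m * x ^ l"
  have "x ^ k = real m + c / x ^ l"
    using assms(1) by (simp add: c_def power_add field_simps)
  moreover have "c \<in> \<rat>" using assms(4) Ints_subset_Rats by (auto simp: c_def)
  ultimately have "x ^ k \<in> \<rat>" using rat by simp
  then have y: "x ^ gcd l k \<in> \<rat>" using Rats_power_gcd assms rat by blast
  obtain s where s: "l = gcd l k * s" by (meson dvdE gcd_dvd1)
  obtain t where t: "k = gcd l k * t" by (meson dvdE gcd_dvd2)
  have t0: "t > 0" using t assms(3) by (cases t) auto
  have xl: "x ^ l = (x ^ gcd l k) ^ s" by (metis s power_mult)
  have xk: "x ^ k = (x ^ gcd l k) ^ t" by (metis t power_mult)
  have "(x ^ gcd l k) ^ (s + t) - real m * (x ^ gcd l k) ^ s = c"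
    unfolding c_def power_add xl[symmetric] xk[symmetric] ..
  with y t0 assms(4) have "x ^ gcd l k \<in> \<int>"
    using rational_root_trinomial_int[OF y t0] c_def by blast
  then have "x ^ k \<in> \<int>" unfolding xk by (rule Ints_power)
  then obtain z where "x ^ k = of_int z" by (auto elim: Ints_cases)
  with assms(5,6) have "int m < z" "z < int m + 1" by linarith+
  then show False by simp
qed

section \<open>Density of the fractional parts and passage to endpoints\<close>

lemma frac_multiple_dense:
  fixes a u v :: real
  assumes "a \<notin> \<rat>" "0 \<le> u" "u < v" "v \<le> 1"
  obtains n :: int where "n > 0" "u < frac (of_int n * a)" "frac (of_int n * a) < v"
proof -
  obtain k :: nat where "k > 0" "\<bar>frac (real k * a) - (u + v) / 2\<bar> < (v - u) / 2"
    using Kronecker_approx_1_explicit[OF assms(1), of "(u + v) / 2" "(v - u) / 2"] assms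
    by auto
  then show ?thesis
    using that[of "int k"] by (auto simp: abs_if field_simps split: if_splits)
qed

text \<open>By density and continuity a weak linear inequality extends to both endpoints. This
  replaces explicit limits in \<theta>.\<close>

lemma linear_le_on_dense:
  fixes a u v p q :: real
  assumes "a \<notin> \<rat>" "0 \<le> u" "u < v" "v \<le> 1"
    and le: "\<And>n. n \<noteq> 0 \<Longrightarrow> u < frac (of_int n * a) \<Longrightarrow> frac (of_int n * a) < v
      \<Longrightarrow> p * frac (of_int n * a) \<le> q"
  shows "p * u \<le> q" "p * v \<le> q"
proof -
  show "p * v \<le> q"
  proof (rule ccontr)
    assume "\<not> p * v \<le> q"
    \<comment> \<open>Within this distance of \<open>v\<close> the excess of \<open>p * v\<close>
      over \<open>q\<close> cannot be used up; the \<open>+ 1\<close> covers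
      \<open>p = 0\<close>.\<close>
    define w where "w = max u (v - (p * v - q) / (\<bar>p\<bar> + 1))"
    have "(p * v - q) / (\<bar>p\<bar> + 1) > 0" using \<open>\<not> p * v \<le> q\<close> by simp
    then have "0 \<le> w" "w < v" using assms by (auto simp: w_def)
    then obtain n where n: "n > 0" "w < frac (of_int n * a)" "frac (of_int n * a) < v"
      using frac_multiple_dense assms by metis
    let ?\<theta> = "frac (of_int n * a)"
    have "v - ?\<theta> < (p * v - q) / (\<bar>p\<bar> + 1)" using n by (auto simp: w_def)
    then have "(v - ?\<theta>) * (\<bar>p\<bar> + 1) < p * v - q" by (simp add: pos_less_divide_eq)
    moreover have "(v - ?\<theta>) * p \<le> (v - ?\<theta>) * (\<bar>p\<bar> + 1)"
      using n by (intro mult_left_mono) auto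
    moreover have "p * ?\<theta> \<le> q" using le n by (auto simp: w_def)
    ultimately show False by (simp add: algebra_simps)
  qed
  show "p * u \<le> q"
  proof (rule ccontr)
    assume "\<not> p * u \<le> q"
    define w where "w = min v (u + (p * u - q) / (\<bar>p\<bar> + 1))"
    have "(p * u - q) / (\<bar>p\<bar> + 1) > 0" using \<open>\<not> p * u \<le> q\<close> by simp
    then have "u < w" "w \<le> 1" using assms by (auto simp: w_def)
    then obtain n where n: "n > 0" "u < frac (of_int n * a)" "frac (of_int n * a) < w"
      using frac_multiple_dense assms by metis
    let ?\<theta> = "frac (of_int n * a)"
    have "?\<theta> - u < (p * u - q) / (\<bar>p\<bar> + 1)" using n by (auto simp: w_def)
    then have "(?\<theta> - u) * (\<bar>p\<bar> + 1) < p * u - q" by (simp add: pos_less_divide_eq)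
    moreover have "(?\<theta> - u) * (- p) \<le> (?\<theta> - u) * (\<bar>p\<bar> + 1)"
      using n by (intro mult_left_mono) auto
    moreover have "p * ?\<theta> \<le> q" using le n by (auto simp: w_def)
    ultimately show False by (simp add: algebra_simps)
  qed
qed

section \<open>Lipschitz homomorphisms modulo 1\<close>

text \<open>
  Writing both \<open>1\<close> and \<open>a\<close> as a multiple of a small \<open>e = frac (n a)\<close> plus a remainder below \<open>e\<close>
  determines the slope \<open>s\<close>, and then \<open>c - s a\<close> modulo 1, up to \<open>O(e)\<close>.
\<close>
lemma approx_integer_combination:
  fixes a c C \<delta> \<epsilon> :: real
  assumes a: "a \<notin> \<rat>" "a > 0" and "\<delta> > 0" "C \<ge> 0" "\<epsilon> > 0"
    and lip: "\<And>n. n \<noteq> 0 \<Longrightarrow> frac (of_int n * a) < \<delta>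
      \<Longrightarrow> \<exists>i::int. \<bar>of_int n * c - of_int i\<bar> \<le> C * frac (of_int n * a)"
  shows "\<exists>s t :: int. \<bar>of_int s\<bar> \<le> 3 * C \<and> \<bar>c - of_int s * a - of_int t\<bar> < \<epsilon>"
proof -
  \<comment> \<open>\<open>D * e\<close> bounds the total error at the end; the \<open>+ 1\<close>
    keeps \<open>D\<close> positive when \<open>C = 0\<close>.\<close>
  define D where "D = (2 + 2 * a) * C + 1"
  have "D > 0" using assms by (simp add: D_def add_nonneg_pos)
  have lip': "\<exists>i::int. \<bar>of_int n * c - of_int i\<bar> \<le> C * frac (of_int n * a)"
    if "frac (of_int n * a) < \<delta>" for n
    using lip[of n] that by (cases "n = 0") (auto intro: exI[of _ 0])
  obtain n where n: "n > 0" "0 < frac (of_int n * a)" "frac (of_int n * a) < min 1 (min \<delta> (\<epsilon> / D))"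
    using frac_multiple_dense[OF a(1), of 0 "min 1 (min \<delta> (\<epsilon> / D))"] assms \<open>D > 0\<close> by auto
  define e where "e = frac (of_int n * a)"
  define j where "j = \<lfloor>of_int n * a\<rfloor>"
  have e: "e > 0" "e < 1" "e < \<delta>" "D * e < \<epsilon>"
    using n \<open>D > 0\<close> by (auto simp: e_def field_simps)
  have na: "of_int n * a = of_int j + e" by (simp add: e_def j_def frac_def)
  obtain i where i: "\<bar>of_int n * c - of_int i\<bar> \<le> C * e"
    using lip' e by (metis e_def)
  define y where "y = of_int n * c - of_int i"
  have y: "\<bar>y\<bar> \<le> C * e" using i by (simp add: y_def)
  \<comment> \<open>Here \<open>x\<close> represents \<open>r a\<close> modulo 1. Passing from
    \<open>r\<close> to \<open>r - K * n\<close> leaves the fractional part \<rho> below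
    \<open>e\<close>, so the Lipschitz bound applies there.\<close>
  have rem: "\<exists>(K::int) t \<rho>. x = of_int K * e + \<rho> \<and> 0 \<le> \<rho> \<and> \<rho> < e
      \<and> \<bar>of_int r * c - of_int K * y - of_int t\<bar> \<le> C * e"
    if "of_int r * a - x \<in> \<int>" for r :: int and x
  proof -
    define K where "K = \<lfloor>x / e\<rfloor>"
    define \<rho> where "\<rho> = x - of_int K * e"
    have "of_int K \<le> x / e" "x / e < of_int K + 1" unfolding K_def by linarith+
    then have \<rho>: "0 \<le> \<rho>" "\<rho> < e" using e by (auto simp: \<rho>_def field_simps)
    have "of_int (r - K * n) * a - \<rho> = of_int r * a - x - of_int K * (of_int n * a - e)"
      by (simp add: \<rho>_def algebra_simps)
    also have "\<dots> \<in> \<int>" using that by (simp add: na)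
    finally have fr: "frac (of_int (r - K * n) * a) = \<rho>"
      using \<rho> e by (subst frac_unique_iff) auto
    then obtain t' where t': "\<bar>of_int (r - K * n) * c - of_int t'\<bar> \<le> C * \<rho>"
      using lip'[of "r - K * n"] \<rho> e by auto
    have "C * \<rho> \<le> C * e" using \<rho> assms by (intro mult_left_mono) auto
    moreover have "of_int (r - K * n) * c - of_int t'
        = of_int r * c - of_int K * y - of_int (t' + K * i)"
      by (simp add: y_def algebra_simps)
    ultimately have "\<bar>of_int r * c - of_int K * y - of_int (t' + K * i)\<bar> \<le> C * e"
      using t' by linarith
    then show ?thesis using \<rho> \<rho>_def by (intro exI[of _ K] exI[of _ "t' + K * i"] exI[of _ \<rho>]) auto
  qed
  \<comment> \<open>Since 1 represents \<open>0 * a\<close> modulo 1, \<open>M * y\<close> is almost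
    an integer; as \<open>M\<close> is about \<open>1 / e\<close>, the slope \<open>y / e\<close> is
    almost the integer \<open>- s'\<close>.\<close>
  obtain M s' \<rho>1 where M: "1 = of_int M * e + \<rho>1" "0 \<le> \<rho>1" "\<rho>1 < e"
      "\<bar>of_int 0 * c - of_int M * y - of_int s'\<bar> \<le> C * e"
    using rem[of 0 1] by auto
  obtain K t \<rho>2 where K: "a = of_int K * e + \<rho>2" "0 \<le> \<rho>2" "\<rho>2 < e"
      "\<bar>c - of_int K * y - of_int t\<bar> \<le> C * e"
    using rem[of 1 a] by auto
  define s where "s = - s'"
  define Y where "Y = y / e"
  have Y: "\<bar>Y\<bar> \<le> C" "y = Y * e" using y e by (auto simp: Y_def field_simps)
  have small: "\<bar>\<rho> * Y\<bar> \<le> C * e" if "0 \<le> \<rho>" "\<rho> < e" for \<rho>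
  proof -
    have "\<bar>\<rho> * Y\<bar> = \<rho> * \<bar>Y\<bar>" using that by (simp add: abs_mult)
    also have "\<dots> \<le> e * C" using that Y by (intro mult_mono) auto
    finally show ?thesis by (simp add: mult.commute)
  qed
  have "Y = (of_int M * e + \<rho>1) * Y" using M(1) by simp
  then have My: "of_int M * y = Y - \<rho>1 * Y" using Y by (simp add: algebra_simps)
  have "a * Y = (of_int K * e + \<rho>2) * Y" using K(1) by simp
  then have Ky: "of_int K * y = a * Y - \<rho>2 * Y" using Y by (simp add: algebra_simps)
  have sY: "\<bar>of_int s - Y\<bar> \<le> 2 * (C * e)"
    using M(4) My small[OF M(2,3)] by (simp add: s_def)
  have "C * e \<le> C" using e assms by (simp add: mult_left_le)
  then have s: "\<bar>of_int s\<bar> \<le> 3 * C" using sY Y by linarith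
  have "\<bar>a * (of_int s - Y)\<bar> \<le> a * (2 * (C * e))"
    using sY a by (simp add: abs_mult)
  then have "\<bar>c - of_int s * a - of_int t\<bar> \<le> 2 * (C * e) + a * (2 * (C * e))"
    using K(4) Ky small[OF K(2,3)] by (simp add: algebra_simps)
  also have "\<dots> \<le> D * e" using e by (simp add: D_def algebra_simps)
  also have "\<dots> < \<epsilon>" by (fact e)
  finally show ?thesis using s by blast
qed

text \<open>Only finitely many slopes \<open>s\<close> satisfy the bound. If none made
  \<open>c - s a\<close> an integer, the distances to the nearest integer would have a positive
  minimum, against arbitrarily good approximation.\<close>

lemma integer_combination_if_Lipschitz:
  fixes a c C \<delta> :: real
  assumes "a \<notin> \<rat>" "a > 0" "\<delta> > 0" "C \<ge> 0"
    and "\<And>n. n \<noteq> 0 \<Longrightarrow> frac (of_int n * a) < \<delta>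
      \<Longrightarrow> \<exists>i::int. \<bar>of_int n * c - of_int i\<bar> \<le> C * frac (of_int n * a)"
  obtains s t :: int where "c = of_int s * a + of_int t"
proof -
  define S where "S = {s::int. \<bar>real_of_int s\<bar> \<le> 3 * C}"
  define g where "g s = min (frac (c - of_int s * a)) (1 - frac (c - of_int s * a))" for s :: int
  have "S \<subseteq> {- \<lceil>3 * C\<rceil>..\<lceil>3 * C\<rceil>}" by (auto simp: S_def) linarith+
  then have "finite S" by (rule finite_subset) simp
  have "\<exists>s\<in>S. g s \<le> 0"
  proof (rule ccontr)
    assume neg: "\<not> (\<exists>s\<in>S. g s \<le> 0)"
    \<comment> \<open>Inserting 1 makes the minimum well defined without checking that
      \<open>S\<close> is nonempty.\<close>
    define \<epsilon> where "\<epsilon> = Min (insert 1 (g ` S))"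
    have "\<epsilon> > 0" using \<open>finite S\<close> neg by (auto simp: \<epsilon>_def not_le)
    then obtain s t :: int where st: "\<bar>of_int s\<bar> \<le> 3 * C" "\<bar>c - of_int s * a - of_int t\<bar> < \<epsilon>"
      using approx_integer_combination assms by meson
    have "\<epsilon> \<le> g s" using \<open>finite S\<close> st by (auto simp: \<epsilon>_def S_def)
    moreover have "g s \<le> \<bar>c - of_int s * a - of_int t\<bar>"
      unfolding g_def frac_def
      by (cases "t \<le> \<lfloor>c - of_int s * a\<rfloor>") linarith+
    ultimately show False using st by linarith
  qed
  then obtain s where "g s \<le> 0" by blast
  then have "frac (c - of_int s * a) = 0"
    using frac_ge_0[of "c - of_int s * a"] frac_lt_1[of "c - of_int s * a"]
    unfolding g_def by linarith
  then have "c = of_int s * a + of_int \<lfloor>c - of_int s * a\<rfloor>" by (simp add: frac_def)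
  then show ?thesis using that by blast
qed

section \<open>From the identity to slope zero\<close>

text \<open>For \<open>m = 1\<close> the reduced identity also admits \<open>s = -1\<close> with
  \<open>-1 < d \<le> 0\<close>; \<open>m1\<close> excludes this, since \<open>a * (d + 1)\<close>
  would then be a positive integer.\<close>

lemma floor_identity_slope_zero:
  fixes a d :: real and m :: nat
  assumes "a > 0" "m > 0" and m1: "m = 1 \<Longrightarrow> d \<le> 0 \<Longrightarrow> a * (d + 1) < 1"
    and d: "d + real m > 0"
    and id: "\<And>n. n \<noteq> 0 \<Longrightarrow> \<lfloor>of_int n * (a * d) - frac (of_int n * a) * d\<rfloor>
      + \<lfloor>real m * frac (of_int n * a)\<rfloor> + 1 = \<lfloor>real m * frac (of_int n * a) + of_int n * (a * d)\<rfloor>"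
  shows "a * d \<in> \<int>" "0 < d" "d < 1"
proof -
  have irr: "a \<notin> \<rat>"
  proof
    assume "a \<in> \<rat>"
    then obtain p q where "q > 0" "a = of_int p / of_int q" by (meson Rats_cases')
    then have "of_int q * a = of_int p" by simp
    then have "frac (of_int q * a) = 0" by simp
    \<comment> \<open>At \<theta> = 0 the identity reads \<open>x + 1 = x\<close>.\<close>
    then show False using id[of q] \<open>q > 0\<close> by (simp del: frac_eq_0_iff)
  qed
  have indep: "of_int z * a \<noteq> of_int w" if "z \<noteq> 0" for z w :: int
  proof
    assume "of_int z * a = of_int w"
    then have "a = of_int w / of_int z" using that by (simp add: field_simps)
    then show False using irr by simp
  qed
  \<comment> \<open>For \<theta> below \<open>1 / m\<close> the middle floor vanishes, so the
    identity places an integer between \<open>n c - \<theta> d\<close> and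
    \<open>n c + m \<theta>\<close>.\<close>
  have lip: "\<exists>i::int. \<bar>of_int n * (a * d) - of_int i\<bar> \<le> (real m + \<bar>d\<bar>) * frac (of_int n * a)"
    if "n \<noteq> 0" "frac (of_int n * a) < 1 / real m" for n
  proof -
    let ?\<theta> = "frac (of_int n * a)"
    define i where "i = \<lfloor>real m * ?\<theta> + of_int n * (a * d)\<rfloor>"
    have "\<lfloor>real m * ?\<theta>\<rfloor> = 0"
      using that \<open>m > 0\<close> by (simp add: floor_eq_iff field_simps)
    then have "\<lfloor>of_int n * (a * d) - ?\<theta> * d\<rfloor> + 1 = i" using id[OF that(1)] by (simp add: i_def)
    then have "of_int n * (a * d) - ?\<theta> * d < of_int i" by linarith
    moreover have "of_int i \<le> real m * ?\<theta> + of_int n * (a * d)" unfolding i_def by linarith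
    moreover have "?\<theta> * d \<le> ?\<theta> * \<bar>d\<bar>" "0 \<le> ?\<theta> * \<bar>d\<bar>" "0 \<le> real m * ?\<theta>"
      by (auto intro: mult_left_mono)
    ultimately have "\<bar>of_int n * (a * d) - of_int i\<bar> \<le> (real m + \<bar>d\<bar>) * ?\<theta>"
      unfolding distrib_right mult.commute[of "\<bar>d\<bar>"] by linarith
    then show ?thesis by blast
  qed
  obtain s t :: int where st: "a * d = of_int s * a + of_int t"
    by (rule integer_combination_if_Lipschitz[OF irr \<open>a > 0\<close>, of "1 / real m" "real m + \<bar>d\<bar>" "a * d"])
      (use \<open>m > 0\<close> lip in auto)
  have E: "\<lfloor>(of_int s - d) * frac (of_int n * a)\<rfloor> + \<lfloor>real m * frac (of_int n * a)\<rfloor> + 1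
      = \<lfloor>of_int (int m + s) * frac (of_int n * a)\<rfloor>" if "n \<noteq> 0" for n
  proof -
    let ?\<theta> = "frac (of_int n * a)"
    define J where "J = s * \<lfloor>of_int n * a\<rfloor> + n * t"
    have "of_int n * (a * d) = of_int s * (of_int n * a) + of_int (n * t)"
      by (simp add: st algebra_simps)
    also have "of_int n * a = ?\<theta> + of_int \<lfloor>of_int n * a\<rfloor>" by (simp add: frac_def)
    finally have nc: "of_int n * (a * d) = of_int s * ?\<theta> + of_int J"
      by (simp add: J_def algebra_simps)
    have "of_int n * (a * d) - ?\<theta> * d = (of_int s - d) * ?\<theta> + of_int J"
      "real m * ?\<theta> + of_int n * (a * d) = of_int (int m + s) * ?\<theta> + of_int J"
      unfolding nc by (simp_all add: algebra_simps)
    then show ?thesis using id[OF that] by simp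
  qed
  \<comment> \<open>\<open>B\<close> dominates all three coefficients of \<theta>, so each product
    stays below 1 in absolute value once \<theta> < \<open>1 / B\<close>.\<close>
  define B where "B = real m + \<bar>of_int s\<bar> + \<bar>of_int s - d\<bar> + 1"
  have B: "B > 0" "B \<ge> 1" "B > real m" using \<open>m > 0\<close> by (auto simp: B_def)
  have absB: "\<bar>r * \<theta>\<bar> < 1" if "0 < \<theta>" "\<theta> < 1 / B" "\<bar>r\<bar> \<le> B" for r \<theta> :: real
  proof -
    have "\<bar>r * \<theta>\<bar> \<le> B * \<theta>" using that by (simp add: abs_mult)
    also have "\<dots> < 1" using that B by (simp add: field_simps)
    finally show ?thesis .
  qed
  have rB: "\<bar>of_int s - d\<bar> \<le> B" "\<bar>real m\<bar> \<le> B" "\<bar>real_of_int (int m + s)\<bar> \<le> B"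
    by (auto simp: B_def)

  txt \<open>Taking \<open>\<theta>\<close> close to \<open>0\<close> gives \<open>- m \<le> s < d\<close>.\<close>
  obtain n0 where n0: "n0 > 0" "0 < frac (of_int n0 * a)" "frac (of_int n0 * a) < 1 / B"
    using frac_multiple_dense[OF irr, of 0 "1 / B"] B by auto
  define \<theta>0 where "\<theta>0 = frac (of_int n0 * a)"
  have \<theta>0: "0 < \<theta>0" "\<bar>(of_int s - d) * \<theta>0\<bar> < 1" "\<bar>real m * \<theta>0\<bar> < 1" "\<bar>of_int (int m + s) * \<theta>0\<bar> < 1"
    unfolding \<theta>0_def using n0 absB rB by blast+
  have "\<lfloor>real m * \<theta>0\<rfloor> = 0" using \<theta>0(1,3) by (simp add: floor_eq_iff)
  then have E0: "\<lfloor>(of_int s - d) * \<theta>0\<rfloor> + 1 = \<lfloor>of_int (int m + s) * \<theta>0\<rfloor>"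
    using E[of n0] n0 by (simp add: \<theta>0_def)
  have ge: "int m + s \<ge> 0"
  proof (rule ccontr)
    assume "\<not> ?thesis"
    then have "of_int (int m + s) * \<theta>0 < 0" using \<theta>0(1) by (intro mult_neg_pos) auto
    then have "\<lfloor>of_int (int m + s) * \<theta>0\<rfloor> < 0" by simp
    then have "\<lfloor>(of_int s - d) * \<theta>0\<rfloor> \<le> - 2" using E0 by linarith
    then show False using \<theta>0(2) by linarith
  qed
  then have "of_int (int m + s) * \<theta>0 \<ge> 0" using \<theta>0(1) by (intro mult_nonneg_nonneg) auto
  then have "\<lfloor>of_int (int m + s) * \<theta>0\<rfloor> = 0" using \<theta>0(4) by (simp add: floor_eq_iff)
  then have "(of_int s - d) * \<theta>0 < 0" using E0 by linarith
  then have sd: "of_int s < d" using \<theta>0(1) by (simp add: mult_less_0_iff)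

  \<comment> \<open>Write \<open>z * \<theta> = z - z * (1 - \<theta>)\<close>, where the subtracted
    term lies strictly between 0 and 1.\<close>
  have near1: "\<lfloor>real_of_int z * \<theta>\<rfloor> = z - 1" if "1 - 1 / B < \<theta>" "\<theta> < 1" "z > 0" "\<bar>real_of_int z\<bar> \<le> B"
    for z \<theta>
  proof -
    have "\<bar>of_int z * (1 - \<theta>)\<bar> < 1" using that absB[of "1 - \<theta>" "of_int z"] by auto
    moreover have "of_int z * (1 - \<theta>) > 0" using that by simp
    ultimately show ?thesis unfolding floor_eq_iff by (simp add: algebra_simps)
  qed
  have B1: "0 \<le> 1 - 1 / B" "1 - 1 / B < 1" using B by auto

  txt \<open>Taking \<open>\<theta>\<close> slightly above \<open>1/m\<close> gives \<open>m + s \<le> d\<close> when \<open>s < 0\<close>.\<close>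
  have above: "d \<ge> real_of_int (int m + s)" if "m \<ge> 2" "s < 0"
  proof -
    \<comment> \<open>Below this bound
      \<open>(m + s) * \<theta> \<le> (m - 1) * \<theta> < 1\<close>, so the right floor is 0 while
      the floor of \<open>m * \<theta>\<close> is already 1.\<close>
    define v where "v = 1 / (real m - 1)"
    have v: "1 / real m < v" "v \<le> 1" using that by (auto simp: v_def field_simps)
    have "(of_int s - d) * (1 / real m) \<le> - 1"
    proof (rule linear_le_on_dense(1)[OF irr _ v])
      show "0 \<le> 1 / real m" by simp
      fix n :: int
      assume n: "n \<noteq> 0" "1 / real m < frac (of_int n * a)" "frac (of_int n * a) < v"
      let ?\<theta> = "frac (of_int n * a)"
      have "1 < real m * ?\<theta>" "real m * ?\<theta> < 2" "(real m - 1) * ?\<theta> < 1"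
        using n that frac_lt_1[of "of_int n * a"] by (auto simp: v_def field_simps)
      moreover have "of_int (int m + s) * ?\<theta> \<le> (real m - 1) * ?\<theta>"
        using that by (intro mult_right_mono) auto
      moreover have "of_int (int m + s) * ?\<theta> \<ge> 0" using ge by (intro mult_nonneg_nonneg) auto
      ultimately have "\<lfloor>real m * ?\<theta>\<rfloor> = 1" "\<lfloor>of_int (int m + s) * ?\<theta>\<rfloor> = 0"
        by (auto simp: floor_eq_iff)
      then have "\<lfloor>(of_int s - d) * ?\<theta>\<rfloor> = - 2" using E[OF n(1)] by linarith
      then show "(of_int s - d) * ?\<theta> \<le> - 1" by linarith
    qed
    then show ?thesis using \<open>m > 0\<close> by (simp add: field_simps)
  qed

  \<comment> \<open>For \<open>s = - m\<close> the right side is 0, and \<theta> tending to 1 gives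
    \<open>d \<le> 0\<close>. If \<open>m \<ge> 2\<close>, the bound from \<theta> near
    \<open>1 / m\<close> forces \<open>d = 0\<close>, against the irrationality of
    \<open>a\<close>.\<close>
  have "s \<noteq> - int m"
  proof
    assume s: "s = - int m"
    have "(d - of_int s) * 1 \<le> - of_int s"
    proof (rule linear_le_on_dense(2)[OF irr B1 order_refl])
      fix n :: int
      assume n: "n \<noteq> 0" "1 - 1 / B < frac (of_int n * a)"
      let ?\<theta> = "frac (of_int n * a)"
      have "\<lfloor>real m * ?\<theta>\<rfloor> = int m - 1"
        using near1[of ?\<theta> "int m"] n rB \<open>m > 0\<close> frac_lt_1 by auto
      then have "\<lfloor>(of_int s - d) * ?\<theta>\<rfloor> = s" using E[OF n(1)] s by simp
      then have "of_int s \<le> (of_int s - d) * ?\<theta>" by linarith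
      then show "(d - of_int s) * ?\<theta> \<le> - of_int s" by (simp add: algebra_simps)
    qed
    then have "d \<le> 0" by simp
    show False
    proof (cases "m = 1")
      case True
      then have "a * (d + 1) = of_int t" using st s by (simp add: algebra_simps)
      moreover have "a * (d + 1) > 0" using d \<open>a > 0\<close> True by simp
      ultimately show False using m1[OF True \<open>d \<le> 0\<close>] by simp
    next
      case False
      then have "d = 0" using above s \<open>m > 0\<close> \<open>d \<le> 0\<close> by force
      then show False using st indep[of "- s" t] s \<open>m > 0\<close> by simp
    qed
  qed
  then have pos: "int m + s > 0" using ge by simp

  txt \<open>Taking \<open>\<theta>\<close> close to \<open>1\<close> gives \<open>d \<le> 1\<close>, hence \<open>s = 0\<close>.\<close>
  have top: "of_int s - 1 \<le> (of_int s - d) * frac (of_int n * a)"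
    if "n \<noteq> 0" "1 - 1 / B < frac (of_int n * a)" for n
  proof -
    let ?\<theta> = "frac (of_int n * a)"
    have "\<lfloor>real m * ?\<theta>\<rfloor> = int m - 1" "\<lfloor>of_int (int m + s) * ?\<theta>\<rfloor> = int m + s - 1"
      using near1[of ?\<theta> "int m"] near1[of ?\<theta> "int m + s"] that rB pos \<open>m > 0\<close> frac_lt_1 by auto
    then have "\<lfloor>(of_int s - d) * ?\<theta>\<rfloor> = s - 1" using E[OF that(1)] by linarith
    then show "of_int s - 1 \<le> (of_int s - d) * ?\<theta>" by linarith
  qed
  have "(d - of_int s) * 1 \<le> 1 - of_int s"
    by (rule linear_le_on_dense(2)[OF irr B1 order_refl])
      (use top in \<open>force simp: algebra_simps\<close>)
  then have "d \<le> 1" by simp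
  have "d \<noteq> 1"
  proof
    assume "d = 1"
    then have "of_int (1 - s) * a = of_int t" using st by (simp add: algebra_simps)
    then have "s = 1" using indep[of "1 - s" t] by auto
    then show False using sd \<open>d = 1\<close> by simp
  qed
  then show "d < 1" using \<open>d \<le> 1\<close> by simp
  have "s \<le> 0" using sd \<open>d < 1\<close> by linarith
  moreover have "\<not> s < 0"
  proof
    assume "s < 0"
    then have "m \<ge> 2" using pos by linarith
    then have "d \<ge> of_int (int m + s)" using above \<open>s < 0\<close> by blast
    then show False using pos \<open>d < 1\<close> by linarith
  qed
  ultimately have "s = 0" by simp
  then show "0 < d" "a * d \<in> \<int>" using sd st by auto
qed

section \<open>The equivalence\<close>

theorem theorem1p4:
  fixes l k m :: nat and \<alpha> :: real
  assumes "l > 0" and "k > 0" and "m > 0" and "\<alpha> > 0"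
  shows "\<alpha> ^ (l + k) - real m * \<alpha> ^ l \<in> \<int> \<inter> {1 ..< (real m + 1) powr (real l / real k)}
    \<longleftrightarrow> (\<forall>n :: int. n \<noteq> 0 \<longrightarrow>
          \<lfloor>of_int \<lfloor>of_int n * \<alpha> ^ l\<rfloor> * \<alpha> ^ k\<rfloor> + \<lfloor>of_int n * real m * \<alpha> ^ l\<rfloor> + 1
            - int m * \<lfloor>of_int n * \<alpha> ^ l\<rfloor>
          = \<lfloor>of_int n * \<alpha> ^ (l + k)\<rfloor>)"
proof -
  define a where "a = \<alpha> ^ l"
  define b where "b = \<alpha> ^ k"
  define d where "d = b - real m"
  have pos: "a > 0" "b > 0" using assms by (auto simp: a_def b_def)
  have c: "\<alpha> ^ (l + k) - real m * \<alpha> ^ l = a * d"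
    by (simp add: a_def b_def d_def power_add algebra_simps)
  \<comment> \<open>This turns the upper bound on \<open>c\<close> into a comparison of
    \<open>b\<close> with \<open>m + 1\<close>, that is, of \<open>d\<close> with 1.\<close>
  have a_powr: "a = b powr (real l / real k)"
  proof -
    have "b powr (real l / real k) = (\<alpha> powr real k) powr (real l / real k)"
      using assms by (simp add: b_def powr_realpow)
    also have "\<dots> = \<alpha> powr real l" using assms by (simp add: powr_powr)
    finally show ?thesis using assms by (simp add: a_def powr_realpow)
  qed
  have "?thesis \<longleftrightarrow> (a * d \<in> \<int> \<and> 1 \<le> a * d \<and> a * d < (real m + 1) powr (real l / real k)
    \<longleftrightarrow> (\<forall>n::int. n \<noteq> 0 \<longrightarrow> \<lfloor>of_int n * (a * d) - frac (of_int n * a) * d\<rfloor>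
      + \<lfloor>real m * frac (of_int n * a)\<rfloor> + 1 = \<lfloor>real m * frac (of_int n * a) + of_int n * (a * d)\<rfloor>))"
    unfolding c unfolding power_add a_def[symmetric] b_def[symmetric] floor_identity_iff d_def[symmetric]
    by simp
  moreover have "\<dots>"
  proof (intro iffI conjI)
    assume L: "a * d \<in> \<int> \<and> 1 \<le> a * d \<and> a * d < (real m + 1) powr (real l / real k)"
    have "a * d > 0" using L by linarith
    then have "d > 0" using pos by (simp add: zero_less_mult_iff)
    have "d < 1"
    proof (rule ccontr)
      assume "\<not> d < 1"
      then have "real m + 1 \<le> b" by (simp add: d_def)
      then have "(real m + 1) powr (real l / real k) \<le> a"
        unfolding a_powr by (intro powr_mono2) auto
      also have "a \<le> a * d" using \<open>\<not> d < 1\<close> pos by simp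
      finally show False using L by simp
    qed
    have irr: "a \<notin> \<rat>"
      unfolding a_def
      by (rule trinomial_power_irrational[OF assms(4,1,2), of m])
        (use L c \<open>d > 0\<close> \<open>d < 1\<close> in \<open>auto simp: d_def b_def\<close>)
    show "\<forall>n::int. n \<noteq> 0 \<longrightarrow> \<lfloor>of_int n * (a * d) - frac (of_int n * a) * d\<rfloor>
      + \<lfloor>real m * frac (of_int n * a)\<rfloor> + 1 = \<lfloor>real m * frac (of_int n * a) + of_int n * (a * d)\<rfloor>"
    proof (intro allI impI)
      fix n :: int assume "n \<noteq> 0"
      let ?\<theta> = "frac (of_int n * a)"
      obtain z where z: "a * d = of_int z" using L by (auto elim: Ints_cases)
      have "of_int n * a \<notin> \<int>"
      proof
        assume "of_int n * a \<in> \<int>"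
        then obtain w where "of_int n * a = of_int w" by (auto elim: Ints_cases)
        then have "a = of_int w / of_int n" using \<open>n \<noteq> 0\<close> by (simp add: field_simps)
        then show False using irr by simp
      qed
      then have "?\<theta> > 0" by simp
      then have "?\<theta> * d > 0" using \<open>d > 0\<close> by simp
      moreover have "?\<theta> * d < 1 * 1"
        using \<open>d > 0\<close> \<open>d < 1\<close> frac_lt_1 \<open>?\<theta> > 0\<close> by (intro mult_strict_mono) auto
      ultimately have "\<lfloor>- (?\<theta> * d)\<rfloor> = - 1" by (simp add: floor_eq_iff)
      moreover have "of_int n * (a * d) - ?\<theta> * d = - (?\<theta> * d) + of_int (n * z)"
        "real m * ?\<theta> + of_int n * (a * d) = real m * ?\<theta> + of_int (n * z)"
        by (simp_all add: z)
      ultimately show "\<lfloor>of_int n * (a * d) - ?\<theta> * d\<rfloor> + \<lfloor>real m * ?\<theta>\<rfloor> + 1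
          = \<lfloor>real m * ?\<theta> + of_int n * (a * d)\<rfloor>"
        by (simp only: floor_add_int[symmetric])
    qed
  next
    assume R: "\<forall>n::int. n \<noteq> 0 \<longrightarrow> \<lfloor>of_int n * (a * d) - frac (of_int n * a) * d\<rfloor>
      + \<lfloor>real m * frac (of_int n * a)\<rfloor> + 1 = \<lfloor>real m * frac (of_int n * a) + of_int n * (a * d)\<rfloor>"
    have "\<alpha> \<noteq> 1"
    proof
      assume "\<alpha> = 1"
      then show False using R[rule_format, of 1] by (simp add: a_def)
    qed
    \<comment> \<open>For \<open>m = 1\<close> the quantity \<open>a * (d + 1)\<close> is
      \<open>\<alpha> ^ (l + k)\<close>, and \<open>d \<le> 0\<close> forces \<alpha> < 1.\<close>
    have m1: "a * (d + 1) < 1" if "m = 1" "d \<le> 0"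
    proof -
      have "\<alpha> ^ k \<le> 1" using that by (simp add: d_def b_def)
      then have "\<alpha> < 1" using \<open>\<alpha> \<noteq> 1\<close> assms one_less_power[of \<alpha> k] by linarith
      then have "\<alpha> ^ (l + k) < 1" using assms by (simp add: power_Suc_less_one power_less_one_iff)
      then show ?thesis using that by (simp add: a_def d_def b_def power_add)
    qed
    have "d + real m > 0" using pos by (simp add: d_def)
    note props = floor_identity_slope_zero[OF pos(1) assms(3) m1 this R[rule_format]]
    show int: "a * d \<in> \<int>" by (rule props(1))
    have d: "0 < d" "d < 1" using props(2,3) by auto
    obtain z where z: "a * d = of_int z" using int by (auto elim: Ints_cases)
    have "a * d > 0" using pos d by simp
    then show "1 \<le> a * d" unfolding z by simp
    have "a * d < a" using pos d by simp
    also have "a < (real m + 1) powr (real l / real k)"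
      unfolding a_powr using d pos assms by (intro powr_less_mono2) (auto simp: d_def)
    finally show "a * d < (real m + 1) powr (real l / real k)" .
  qed
  ultimately show ?thesis by blast
qed

end
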